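(* Let $m\ge 2$ be a fixed integer, let $p,q\in(0,1)$ be fixed constants with $p>q$, let $t>0$ be a constant, and let $\alpha=\alpha_n=\frac{t\log n}{n^{m-1}}$. Define $$I_m(p,q)=\frac{2^{m-1}(m-1)!}{(\sqrt{p}-\sqrt{q})^{2}+(\sqrt{1-p}-\sqrt{1-q})^{2}}.$$ Let $\sigma\in\{\pm1\}^n$ be the true label vector and $A$ the observed censored hypergraph of the model $\mathcal{H}_m(n,p,q,\alpha)$. If $t>I_m(p,q)$, then the maximum likelihood estimator $\hat\sigma=\hat\sigma(A)$ exactly recovers the true label with probability $1-o(1)$, i.e. $$\mathbb{P}\big(\exists\, s\in\{\pm1\}:\ \hat\sigma=s\sigma\big)=1-o(1)\qquad (n\to\infty).$$
   Context: Censored $m$-uniform hypergraph stochastic block model $\mathcal{H}_m(n,p,q,\alpha)$: the node set is $\{1,\dots,n\}$. Each node $i$ independently receives a label $\sigma_i$ with $\mathbb{P}(\sigma_i=+1)=\mathbb{P}(\sigma_i=-1)=\tfrac12$; $\sigma=(\sigma_1,\dots,\sigma_n)$ is the true label vector, and $I_+(\sigma)=\{i:\sigma_i=+1\}$, $I_-(\sigma)=\{i:\sigma_i=-1\}$ are the two communities. Given $\sigma$, independently over all $m$-element subsets $\{i_1,\dots,i_m\}$ of nodes, the subset is a hyperedge with probability $p$ if it is contained in $I_+(\sigma)$ or in $I_-(\sigma)$, and with probability $q$ otherwise. Independently for each $m$-subset, its status is revealed with probability $\alpha$. The observation $A$ assigns to each $m$-subset a value $A_{i_1\cdots i_m}\in\{1,0,*\}$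 (symmetric in the indices): $1$ if revealed and present, $0$ if revealed and absent, $*$ if not revealed (censored). The value $\alpha_n=\frac{t\log n}{n^{m-1}}$ is at most $1$ for all large $n$. The maximum likelihood estimator is a maximizer over $\eta\in\{\pm1\}^n$ of the likelihood of $A$ given label vector $\eta$; equivalently, a maximizer of $$l(\eta)=\sum_{1\le i_1<\dots<i_m\le n}\Big[\log\tfrac{p}{q}\,\mathbf 1[A_{i_1\cdots i_m}=1]+\log\tfrac{1-p}{1-q}\,\mathbf 1[A_{i_1\cdots i_m}=0]\Big]\mathbf 1[\eta_{i_1}=\dots=\eta_{i_m}].$$ Since $l(\eta)=l(-\eta)$, recovery is understood up to a global sign. *)

theory Defs
  imports "HOL-Probability.Probability"
begin

text \<open>
  Labels are the integers \<open>1\<close> and \<open>-1\<close>. A labelling of the nodes \<open>1, \<dots>, n\<close> is an extensional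
  function, that is, it is \<open>undefined\<close> outside \<open>{1..n}\<close>.
\<close>

definition labelings :: "nat \<Rightarrow> (nat \<Rightarrow> int) set" where
  "labelings n = {1..n} \<rightarrow>\<^sub>E {1, -1}"

definition I_plus :: "nat \<Rightarrow> (nat \<Rightarrow> int) \<Rightarrow> nat set" where
  "I_plus n \<sigma> = {i \<in> {1..n}. \<sigma> i = 1}"

definition I_minus :: "nat \<Rightarrow> (nat \<Rightarrow> int) \<Rightarrow> nat set" where
  "I_minus n \<sigma> = {i \<in> {1..n}. \<sigma> i = -1}"

definition m_subsets :: "nat \<Rightarrow> nat \<Rightarrow> nat set set" where
  "m_subsets m n = {e. e \<subseteq> {1..n} \<and> card e = m}"

text \<open>
  The observed values \<open>1\<close> (revealed and present), \<open>0\<close> (revealed and absent) and \<open>*\<close> (not revealed).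
  Indexing an observation by \<open>m\<close>-element sets, rather than by \<open>m\<close>-tuples, builds in its symmetry.
\<close>

datatype obs = Present | Absent | Censored

definition edge_prob :: "nat \<Rightarrow> real \<Rightarrow> real \<Rightarrow> (nat \<Rightarrow> int) \<Rightarrow> nat set \<Rightarrow> real" where
  "edge_prob n p q \<sigma> e = (if e \<subseteq> I_plus n \<sigma> \<or> e \<subseteq> I_minus n \<sigma> then p else q)"

definition label_pmf :: "nat \<Rightarrow> (nat \<Rightarrow> int) pmf" where
  "label_pmf n = Pi_pmf {1..n} undefined (\<lambda>_. pmf_of_set {1, -1})"

definition entry_pmf :: "real \<Rightarrow> real \<Rightarrow> obs pmf" where
  "entry_pmf r \<alpha> =
     do {
       present \<leftarrow> bernoulli_pmf r;
       revealed \<leftarrow> bernoulli_pmf \<alpha>;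
       return_pmf (if revealed then (if present then Present else Absent) else Censored)
     }"

text \<open>
  The conditional law of the observation given the labels. Note that \<open>bernoulli_pmf\<close> truncates its
  parameter to the unit interval, so this is a probability law also if \<open>\<alpha> > 1\<close>.
\<close>

definition observation_pmf ::
    "nat \<Rightarrow> nat \<Rightarrow> real \<Rightarrow> real \<Rightarrow> real \<Rightarrow> (nat \<Rightarrow> int) \<Rightarrow> (nat set \<Rightarrow> obs) pmf" where
  "observation_pmf m n p q \<alpha> \<sigma> =
     Pi_pmf (m_subsets m n) undefined (\<lambda>e. entry_pmf (edge_prob n p q \<sigma> e) \<alpha>)"

definition censored_hsbm ::
    "nat \<Rightarrow> nat \<Rightarrow> real \<Rightarrow> real \<Rightarrow> real \<Rightarrow> ((nat \<Rightarrow> int) \<times> (nat set \<Rightarrow> obs)) pmf" where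
  "censored_hsbm m n p q \<alpha> =
     do {
       \<sigma> \<leftarrow> label_pmf n;
       A \<leftarrow> observation_pmf m n p q \<alpha> \<sigma>;
       return_pmf (\<sigma>, A)
     }"

definition likelihood ::
    "nat \<Rightarrow> nat \<Rightarrow> real \<Rightarrow> real \<Rightarrow> real \<Rightarrow> (nat set \<Rightarrow> obs) \<Rightarrow> (nat \<Rightarrow> int) \<Rightarrow> real" where
  "likelihood m n p q \<alpha> A \<eta> = pmf (observation_pmf m n p q \<alpha> \<eta>) A"

text \<open>
  Maximizers need not be unique (they come at least in pairs of opposite sign), so being a maximum
  likelihood estimate is a predicate.
\<close>

definition is_MLE ::
    "nat \<Rightarrow> nat \<Rightarrow> real \<Rightarrow> real \<Rightarrow> real \<Rightarrow> (nat set \<Rightarrow> obs) \<Rightarrow> (nat \<Rightarrow> int) \<Rightarrow> bool" where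
  "is_MLE m n p q \<alpha> A \<eta> \<longleftrightarrow>
     is_arg_max (likelihood m n p q \<alpha> A) (\<lambda>\<eta>'. \<eta>' \<in> labelings n) \<eta>"

definition I_threshold :: "nat \<Rightarrow> real \<Rightarrow> real \<Rightarrow> real" where
  "I_threshold m p q =
     2 ^ (m - 1) * fact (m - 1) /
     ((sqrt p - sqrt q)\<^sup>2 + (sqrt (1 - p) - sqrt (1 - q))\<^sup>2)"

end

theory Submission
  imports Defs "HOL-Real_Asymp.Real_Asymp"
begin

text \<open>
  If a labelling \<open>\<eta>\<close> is at least as likely as the truth \<open>\<sigma>\<close>, then the likelihood of \<open>\<sigma>\<close> is at most
  the geometric mean of both, so this happens with probability at most the Bhattacharyya
  coefficient of the two product laws. It factors over the \<open>m\<close>-subsets: a subset that is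
  monochromatic for exactly one of \<open>\<sigma>\<close>, \<open>\<eta>\<close> contributes \<open>1 - \<alpha> D / 2\<close>, where \<open>D\<close> is the denominator
  of \<open>I_threshold\<close>, and all others contribute \<open>1\<close>.

  If \<open>\<eta>\<close> arises from \<open>\<sigma>\<close> by flipping the \<open>k\<close> nodes of \<open>S\<close>, then adding a node of \<open>S\<close> to \<open>m - 1\<close> nodes
  of the same label outside \<open>S\<close> gives such a subset. By convexity there are at least about
  \<open>2 k ((n - k) / 2)\<^sup>m\<^sup>-\<^sup>1 / (m - 1)!\<close> of these, whether or not the communities are balanced. Up to the
  global sign \<open>k \<le> n / 2\<close>, and the union bound over the \<open>n choose k\<close> sets \<open>S\<close> is dominated by a
  geometric series with ratio \<open>n powr - \<delta>\<close>.
\<close>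

section \<open>The Bhattacharyya bound\<close>

lemma prob_likelihood_ge_le_sum_sqrt:
  assumes "finite F" "set_pmf M \<subseteq> F"
  shows "measure_pmf.prob M {x. pmf M x \<le> pmf N x} \<le> (\<Sum>x\<in>F. sqrt (pmf M x * pmf N x))"
proof -
  have "measure_pmf.prob M {x. pmf M x \<le> pmf N x}
      = measure_pmf.prob M ({x. pmf M x \<le> pmf N x} \<inter> F)"
    by (rule measure_pmf.finite_measure_eq_AE) (use assms in \<open>auto simp: AE_measure_pmf_iff\<close>)
  also have "\<dots> = (\<Sum>x\<in>{x. pmf M x \<le> pmf N x} \<inter> F. pmf M x)"
    by (rule measure_measure_pmf_finite) (use assms in auto)
  also have "\<dots> \<le> (\<Sum>x\<in>{x. pmf M x \<le> pmf N x} \<inter> F. sqrt (pmf M x * pmf N x))"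
  proof (rule sum_mono)
    fix x assume "x \<in> {x. pmf M x \<le> pmf N x} \<inter> F"
    then have "(pmf M x)\<^sup>2 \<le> pmf M x * pmf N x"
      by (auto simp: power2_eq_square intro!: mult_left_mono)
    then show "pmf M x \<le> sqrt (pmf M x * pmf N x)"
      by (rule real_le_rsqrt)
  qed
  also have "\<dots> \<le> (\<Sum>x\<in>F. sqrt (pmf M x * pmf N x))"
    by (rule sum_mono2) (use assms in auto)
  finally show ?thesis .
qed

lemma UNIV_obs: "(UNIV :: obs set) = {Present, Absent, Censored}"
  using obs.exhaust by auto

lemma real_sqrt_prod: "sqrt (\<Prod>x\<in>A. f x) = (\<Prod>x\<in>A. sqrt (f x))"
  by (induction A rule: infinite_finite_induct) (simp_all add: real_sqrt_mult)

text \<open>The Bhattacharyya coefficient is multiplicative over independent coordinates: masses of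
  product laws factor, and distributivity turns the sum over functions into a product of
  sums.\<close>

lemma sum_sqrt_Pi_pmf:
  fixes P Q :: "'a \<Rightarrow> obs pmf"
  assumes "finite E"
  shows "(\<Sum>A\<in>E \<rightarrow>\<^sub>E UNIV. sqrt (pmf (Pi_pmf E undefined P) A * pmf (Pi_pmf E undefined Q) A))
       = (\<Prod>e\<in>E. \<Sum>a\<in>UNIV. sqrt (pmf (P e) a * pmf (Q e) a))"
proof -
  have "(\<Sum>A\<in>E \<rightarrow>\<^sub>E UNIV. sqrt (pmf (Pi_pmf E undefined P) A * pmf (Pi_pmf E undefined Q) A))
      = (\<Sum>A\<in>E \<rightarrow>\<^sub>E UNIV. \<Prod>e\<in>E. sqrt (pmf (P e) (A e) * pmf (Q e) (A e)))"
  proof (rule sum.cong[OF refl])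
    fix A :: "'a \<Rightarrow> obs"
    assume "A \<in> E \<rightarrow>\<^sub>E UNIV"
    \<comment> \<open>The value \<open>undefined\<close> is also the default of
      \<open>Pi_pmf\<close>, so extensional functions get the plain product mass.\<close>
    then have "\<And>x. x \<notin> E \<Longrightarrow> A x = undefined"
      by (auto simp: PiE_def extensional_def)
    then show "sqrt (pmf (Pi_pmf E undefined P) A * pmf (Pi_pmf E undefined Q) A)
        = (\<Prod>e\<in>E. sqrt (pmf (P e) (A e) * pmf (Q e) (A e)))"
      using assms by (simp add: pmf_Pi real_sqrt_mult real_sqrt_prod prod.distrib)
  qed
  also have "\<dots> = (\<Prod>e\<in>E. \<Sum>a\<in>UNIV. sqrt (pmf (P e) a * pmf (Q e) a))"
    by (rule prod_sum_PiE[symmetric]) (use assms in \<open>auto simp: UNIV_obs\<close>)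
  finally show ?thesis .
qed

lemma pmf_entry:
  assumes "0 \<le> r" "r \<le> 1" "0 \<le> a" "a \<le> 1"
  shows "pmf (entry_pmf r a) Present = r * a" "pmf (entry_pmf r a) Absent = (1 - r) * a"
    "pmf (entry_pmf r a) Censored = 1 - a"
  using assms by (simp_all add: entry_pmf_def pmf_bind)

text \<open>The value \<open>Censored\<close> contributes \<open>1 - a\<close>. The two revealed
  values contribute \<open>a\<close> times the Bhattacharyya coefficient of two Bernoulli laws,
  which is one minus half the sum of the two squares.\<close>

lemma sum_sqrt_entry_pmf:
  assumes "0 \<le> r" "r \<le> 1" "0 \<le> s" "s \<le> 1" "0 \<le> a" "a \<le> 1"
  shows "(\<Sum>x\<in>UNIV. sqrt (pmf (entry_pmf r a) x * pmf (entry_pmf s a) x))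
       = 1 - a * ((sqrt r - sqrt s)\<^sup>2 + (sqrt (1 - r) - sqrt (1 - s))\<^sup>2) / 2"
proof -
  have "sqrt (r * a * (s * a)) = a * (sqrt r * sqrt s)"
    "sqrt ((1 - r) * a * ((1 - s) * a)) = a * (sqrt (1 - r) * sqrt (1 - s))"
    "sqrt ((1 - a) * (1 - a)) = 1 - a"
    using assms by (simp_all add: real_sqrt_mult)
  moreover have "(sqrt r - sqrt s)\<^sup>2 = r + s - 2 * (sqrt r * sqrt s)"
    "(sqrt (1 - r) - sqrt (1 - s))\<^sup>2 = (1 - r) + (1 - s) - 2 * (sqrt (1 - r) * sqrt (1 - s))"
    using assms by (simp_all add: power2_diff)
  ultimately show ?thesis
    unfolding UNIV_obs using assms
    by (simp add: pmf_entry del: real_sqrt_mult_self) (simp add: field_simps)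
qed

definition mono_edge :: "nat \<Rightarrow> (nat \<Rightarrow> int) \<Rightarrow> nat set \<Rightarrow> bool" where
  "mono_edge n \<sigma> e \<longleftrightarrow> e \<subseteq> I_plus n \<sigma> \<or> e \<subseteq> I_minus n \<sigma>"

text \<open>Entries outside this set have the same law under both labellings, so only its members
  can lower the Bhattacharyya coefficient.\<close>

definition discordant :: "nat \<Rightarrow> nat \<Rightarrow> (nat \<Rightarrow> int) \<Rightarrow> (nat \<Rightarrow> int) \<Rightarrow> nat set set" where
  "discordant m n \<sigma> \<eta> = {e \<in> m_subsets m n. mono_edge n \<sigma> e \<noteq> mono_edge n \<eta> e}"

lemma finite_m_subsets [simp]: "finite (m_subsets m n)"
  by (rule finite_subset[of _ "Pow {1..n}"]) (auto simp: m_subsets_def)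

lemma prob_likelihood_ge:
  fixes p q a :: real
  assumes "0 < p" "p < 1" "0 < q" "q < 1" "0 \<le> a" "a \<le> 1"
  defines "D \<equiv> (sqrt p - sqrt q)\<^sup>2 + (sqrt (1 - p) - sqrt (1 - q))\<^sup>2"
  shows "measure_pmf.prob (observation_pmf m n p q a \<sigma>)
           {A. likelihood m n p q a A \<sigma> \<le> likelihood m n p q a A \<eta>}
       \<le> exp (- (a * D / 2 * real (card (discordant m n \<sigma> \<eta>))))"
proof -
  let ?E = "m_subsets m n"
  let ?bc = "\<lambda>e. \<Sum>x\<in>UNIV. sqrt (pmf (entry_pmf (edge_prob n p q \<sigma> e) a) x *
                                   pmf (entry_pmf (edge_prob n p q \<eta> e) a) x)"
  have bc: "?bc e = (if mono_edge n \<sigma> e \<noteq> mono_edge n \<eta> e then 1 - a * D / 2 else 1)" for e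
  proof -
    have *: "edge_prob n p q \<rho> e = (if mono_edge n \<rho> e then p else q)" for \<rho>
      by (simp add: edge_prob_def mono_edge_def)
    show ?thesis
      unfolding * using assms(1-6)
      by (subst sum_sqrt_entry_pmf) (auto simp: D_def power2_commute)
  qed
  have "set_pmf (observation_pmf m n p q a \<sigma>) \<subseteq> ?E \<rightarrow>\<^sub>E UNIV"
    unfolding observation_pmf_def using set_Pi_pmf_subset[OF finite_m_subsets]
    by (fastforce simp: PiE_def extensional_def)
  then have "measure_pmf.prob (observation_pmf m n p q a \<sigma>)
           {A. likelihood m n p q a A \<sigma> \<le> likelihood m n p q a A \<eta>}
      \<le> (\<Sum>A\<in>?E \<rightarrow>\<^sub>E UNIV. sqrt (pmf (observation_pmf m n p q a \<sigma>) A *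
                               pmf (observation_pmf m n p q a \<eta>) A))"
    unfolding likelihood_def
    by (intro prob_likelihood_ge_le_sum_sqrt finite_PiE) (auto simp: UNIV_obs)
  also have "\<dots> = (\<Prod>e\<in>?E. ?bc e)"
    unfolding observation_pmf_def by (rule sum_sqrt_Pi_pmf) simp
  also have "\<dots> = (\<Prod>e\<in>discordant m n \<sigma> \<eta>. 1 - a * D / 2)"
    unfolding bc discordant_def by (rule prod.inter_filter[symmetric]) simp
  also have "\<dots> \<le> (\<Prod>e\<in>discordant m n \<sigma> \<eta>. exp (- (a * D / 2)))"
  proof (rule prod_mono)
    fix e assume "e \<in> discordant m n \<sigma> \<eta>"
    \<comment> \<open>Comparing products factor by factor needs nonnegative factors; this one is a
      sum of square roots.\<close>
    then have "1 - a * D / 2 = ?bc e"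
      unfolding bc by (simp add: discordant_def)
    also have "\<dots> \<ge> 0"
      by (intro sum_nonneg) simp
    finally show "0 \<le> 1 - a * D / 2 \<and> 1 - a * D / 2 \<le> exp (- (a * D / 2))"
      using exp_ge_add_one_self[of "- (a * D / 2)"] by simp
  qed
  also have "\<dots> = exp (- (a * D / 2 * real (card (discordant m n \<sigma> \<eta>))))"
    by (simp add: exp_of_nat_mult[symmetric] mult.commute)
  finally show ?thesis .
qed

section \<open>Counting discordant subsets\<close>

definition flip :: "nat set \<Rightarrow> (nat \<Rightarrow> int) \<Rightarrow> nat \<Rightarrow> int" where
  "flip S \<sigma> = (\<lambda>i. if i \<in> S then - \<sigma> i else \<sigma> i)"

text \<open>The nodes of \<open>X\<close> keep their common label while \<open>v\<close> changes
  sides, so exactly one of the two labellings makes the set monochromatic. With \<open>X\<close>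
  empty, the singleton would be monochromatic for both; \<open>r \<ge> 1\<close> excludes
  this.\<close>

lemma insert_discordant:
  assumes \<sigma>: "\<sigma> \<in> labelings n" and S: "S \<subseteq> {1..n}" and v: "v \<in> S"
    and X: "X \<subseteq> I_plus n \<sigma> - S \<or> X \<subseteq> I_minus n \<sigma> - S" "finite X" "card X = r" and r: "r \<ge> 1"
  shows "insert v X \<in> discordant (Suc r) n \<sigma> (flip S \<sigma>)"
proof -
  have "X \<noteq> {}" using X r by auto
  then obtain w where w: "w \<in> X" by auto
  have "\<sigma> v \<in> {1, -1}" using \<sigma> S v by (auto simp: labelings_def)
  moreover have "v \<notin> X" "X \<subseteq> {1..n}" "v \<in> {1..n}"
    using X v S by (auto simp: I_plus_def I_minus_def)
  ultimately show ?thesis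
    using X v w
    unfolding discordant_def m_subsets_def mono_edge_def I_plus_def I_minus_def flip_def
    by (fastforce simp: subset_iff)
qed

lemma card_discordant_ge:
  assumes \<sigma>: "\<sigma> \<in> labelings n" and S: "S \<subseteq> {1..n}" and r: "r \<ge> 1"
  shows "card S * ((card (I_plus n \<sigma> - S) choose r) + (card (I_minus n \<sigma> - S) choose r))
       \<le> card (discordant (Suc r) n \<sigma> (flip S \<sigma>))"
proof -
  define F where "F = (\<lambda>B :: nat set. {X. X \<subseteq> B \<and> card X = r})"
  let ?P = "I_plus n \<sigma> - S" and ?M = "I_minus n \<sigma> - S"
  have fin: "finite ?P" "finite ?M" by (simp_all add: I_plus_def I_minus_def)
  then have finF: "finite (F ?P)" "finite (F ?M)" by (auto simp: F_def)
  \<comment> \<open>A common member would be a subset of two disjoint communities, hence empty,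
    against \<open>r \<ge> 1\<close>.\<close>
  have "F ?P \<inter> F ?M = {}"
    using r by (fastforce simp: F_def I_plus_def I_minus_def subset_iff card_eq_0_iff
        dest!: card_gt_0_iff[THEN iffD1])
  then have "card S * ((card ?P choose r) + (card ?M choose r)) = card (S \<times> (F ?P \<union> F ?M))"
    using fin finF by (simp add: card_cartesian_product card_Un_disjoint F_def n_subsets)
  also have "\<dots> = card ((\<lambda>(v, X). insert v X) ` (S \<times> (F ?P \<union> F ?M)))"
  proof (rule card_image[symmetric], rule inj_onI, clarify)
    fix v X v' X'
    assume *: "v \<in> S" "v' \<in> S" "X \<in> F ?P \<union> F ?M" "X' \<in> F ?P \<union> F ?M" "insert v X = insert v' X'"
    \<comment> \<open>Injectivity: \<open>v\<close> is recovered as the only element of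
      \<open>insert v X\<close> in \<open>S\<close>.\<close>
    then have "X \<inter> S = {}" "X' \<inter> S = {}" by (auto simp: F_def)
    moreover from this * have "v \<notin> X'" "v \<notin> X" "v' \<notin> X'" by auto
    ultimately have "v = v'" using *(5) by auto
    with \<open>v \<notin> X\<close> \<open>v' \<notin> X'\<close> *(5) show "v = v' \<and> X = X'" by (simp add: insert_ident)
  qed
  also have "\<dots> \<le> card (discordant (Suc r) n \<sigma> (flip S \<sigma>))"
  proof (rule card_mono)
    show "finite (discordant (Suc r) n \<sigma> (flip S \<sigma>))" by (simp add: discordant_def)
    show "(\<lambda>(v, X). insert v X) ` (S \<times> (F ?P \<union> F ?M)) \<subseteq> discordant (Suc r) n \<sigma> (flip S \<sigma>)"
    proof clarify
      fix v X assume "v \<in> S" "X \<in> F ?P \<union> F ?M"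
      then show "insert v X \<in> discordant (Suc r) n \<sigma> (flip S \<sigma>)"
        using fin by (intro insert_discordant \<sigma> S r) (auto simp: F_def intro: finite_subset)
    qed
  qed
  finally show ?thesis .
qed

text \<open>The right side is a falling factorial with \<open>r\<close> factors, each at least
  \<open>a - r\<close>. Truncated subtraction covers \<open>a < r\<close>, and the shift by
  \<open>r\<close> is preserved when \<open>a\<close> and \<open>r\<close> both drop by one in the
  induction.\<close>

lemma power_diff_le_fact_mult_binomial: "(a - r) ^ r \<le> fact r * (a choose r)"
proof (induction r arbitrary: a)
  case (Suc r)
  show ?case
  proof (cases a)
    case (Suc b)
    have "(a - Suc r) ^ Suc r = (b - r) * (b - r) ^ r"
      by (simp add: Suc)
    also have "\<dots> \<le> Suc b * (fact r * (b choose r))"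
      by (intro mult_mono Suc.IH) auto
    also have "\<dots> = fact r * (Suc b * (b choose r))"
      by (rule mult.left_commute)
    also have "\<dots> = fact (Suc r) * (a choose Suc r)"
      using Suc_times_binomial[of r b] by (simp only: Suc fact_Suc mult_ac of_nat_id)
    finally show ?thesis .
  qed simp
qed simp

lemma two_mult_mean_power_le:
  fixes x y :: real
  assumes "0 \<le> x" "0 \<le> y"
  shows "2 * ((x + y) / 2) ^ r \<le> x ^ r + y ^ r"
proof (induction r)
  case (Suc r)
  \<comment> \<open>Powers are monotone on nonnegative reals, so both factors have the same sign;
    expanding the product gives \<open>*\<close>.\<close>
  have "(x - y) * (x ^ r - y ^ r) \<ge> 0"
  proof (cases "x \<le> y")
    case True
    then show ?thesis
      using power_mono[of x y r] assms by (intro mult_nonpos_nonpos) auto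
  next
    case False
    then show ?thesis
      using power_mono[of y x r] assms by (intro mult_nonneg_nonneg) auto
  qed
  then have *: "(x + y) / 2 * (x ^ r + y ^ r) \<le> x ^ Suc r + y ^ Suc r"
    by (simp add: field_simps)
  have "2 * ((x + y) / 2) ^ Suc r = (x + y) / 2 * (2 * ((x + y) / 2) ^ r)"
    by simp
  also have "\<dots> \<le> (x + y) / 2 * (x ^ r + y ^ r)"
    using assms Suc by (intro mult_left_mono) auto
  also note *
  finally show ?case .
qed simp

text \<open>The communities outside \<open>S\<close> have total size \<open>n - card S\<close>;
  convexity replaces both sizes by their mean, which removes the dependence on balance. Each of the
  two binomial estimates costs \<open>r\<close>, hence \<open>2 * r\<close>.\<close>

lemma discordant_lower_bound:
  assumes \<sigma>: "\<sigma> \<in> labelings n" and S: "S \<subseteq> {1..n}" and r: "r \<ge> 1"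
    and k: "card S + 2 * r \<le> n"
  shows "real (card S) * (2 * ((real n - real (card S) - 2 * real r) / 2) ^ r) / fact r
       \<le> real (card (discordant (Suc r) n \<sigma> (flip S \<sigma>)))"
proof -
  define a where "a = card (I_plus n \<sigma> - S)"
  define d where "d = card (I_minus n \<sigma> - S)"
  have "(I_plus n \<sigma> - S) \<union> (I_minus n \<sigma> - S) = {1..n} - S"
    using \<sigma> by (auto simp: I_plus_def I_minus_def labelings_def)
  moreover have "card ((I_plus n \<sigma> - S) \<union> (I_minus n \<sigma> - S)) = a + d"
    unfolding a_def d_def by (rule card_Un_disjoint) (auto simp: I_plus_def I_minus_def)
  ultimately have "a + d = card ({1..n} - S)"
    by simp
  also have "\<dots> = n - card S"
    using S by (simp add: card_Diff_subset finite_subset)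
  finally have ad: "a + d = n - card S" .
  have "real a + real d = real n - real (card S)"
    using ad k by linarith
  \<comment> \<open>Nonnegativity of the base, from \<open>k\<close>, is what monotonicity of powers
    requires; truncated subtraction only enlarges the upper bound.\<close>
  then have "0 \<le> (real n - real (card S) - 2 * real r) / 2"
    "(real n - real (card S) - 2 * real r) / 2 \<le> (real (a - r) + real (d - r)) / 2"
    using k by simp_all
  then have "2 * ((real n - real (card S) - 2 * real r) / 2) ^ r
      \<le> 2 * ((real (a - r) + real (d - r)) / 2) ^ r"
    by (intro mult_left_mono power_mono) simp_all
  also have "\<dots> \<le> real ((a - r) ^ r + (d - r) ^ r)"
    using two_mult_mean_power_le[of "real (a - r)" "real (d - r)" r] by simp
  also have "\<dots> \<le> real (fact r * (a choose r) + fact r * (d choose r))"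
    by (intro of_nat_mono add_mono power_diff_le_fact_mult_binomial)
  finally have "2 * ((real n - real (card S) - 2 * real r) / 2) ^ r / fact r
      \<le> real ((a choose r) + (d choose r))"
    by (simp add: field_simps)
  then have "real (card S) * (2 * ((real n - real (card S) - 2 * real r) / 2) ^ r / fact r)
      \<le> real (card S) * real ((a choose r) + (d choose r))"
    by (rule mult_left_mono) simp
  also have "\<dots> = real (card S * ((a choose r) + (d choose r)))"
    by simp
  also have "\<dots> \<le> real (card (discordant (Suc r) n \<sigma> (flip S \<sigma>)))"
    unfolding a_def d_def by (intro of_nat_mono card_discordant_ge \<sigma> S r)
  finally show ?thesis by simp
qed

section \<open>The union bound\<close>

text \<open>There are two regimes. For \<open>k\<close> at most a small fraction of
  \<open>n\<close>, the last factor is near 1 and \<open>\<tau> > 1\<close> beats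
  \<open>n choose k \<le> n ^ k\<close>. For larger \<open>k\<close> that factor is only bounded
  below, but \<open>2 ^ n\<close> is then exponential in \<open>k\<close>, which the extra
  \<open>ln n\<close> outgrows.\<close>

lemma binomial_mult_exp_bound:
  fixes \<tau> :: real
  assumes "\<tau> > 1" "r \<ge> 1"
  shows "\<exists>\<delta>>0. \<forall>\<^sub>F n in sequentially. \<forall>k\<in>{1..n div 2}.
     real (n choose k) * exp (- (real k * (\<tau> * ln (real n) * (1 - (real k + 2 * real r) / real n) ^ r)))
       \<le> exp (- (\<delta> * ln (real n))) ^ k"
proof -
  \<comment> \<open>Chosen so that \<open>\<tau> * c ^ r\<close> is the midpoint of 1 and
    \<open>\<tau>\<close>, which leaves a margin of \<open>(\<tau> - 1) / 2\<close>.\<close>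
  define c where "c = root r ((1 + 1 / \<tau>) / 2)"
  have c: "0 < c" "c < 1" "\<tau> * c ^ r = (\<tau> + 1) / 2"
    using assms by (auto simp: c_def field_simps real_root_pow_pos2)
  \<comment> \<open>Half of \<open>1 - c\<close> is spent on \<open>k / n\<close>, the other half on
    \<open>2 * r / n\<close>.\<close>
  define \<epsilon> where "\<epsilon> = (1 - c) / 2"
  have \<epsilon>: "\<epsilon> > 0" using c by (simp add: \<epsilon>_def)
  \<comment> \<open>From \<open>k \<le> n / 2\<close> and \<open>8 * r \<le> n\<close>, the base
    \<open>y\<close> below is at least \<open>1 - 1/2 - 1/4\<close>.\<close>
  define c2 where "c2 = \<tau> * (1 / 4) ^ r"
  have c2: "c2 > 0" using assms by (simp add: c2_def)
  \<comment> \<open>One entry per regime; for large \<open>k\<close>, half of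
    \<open>c2 * ln n\<close> absorbs the binomial coefficient and the other half remains.\<close>
  define \<delta> where "\<delta> = min ((\<tau> - 1) / 2) (c2 / 2)"
  have \<delta>: "\<delta> > 0" "\<delta> \<le> (\<tau> - 1) / 2" "\<delta> \<le> c2 / 2"
    unfolding \<delta>_def using assms c2 by (simp, linarith+)
  have "\<forall>\<^sub>F n in sequentially. real n \<ge> 2 * real r / \<epsilon>"
    by real_asymp
  moreover have "\<forall>\<^sub>F n in sequentially. ln (real n) \<ge> 2 * ln 2 / (\<epsilon> * c2)"
    by real_asymp
  moreover have "\<forall>\<^sub>F n in sequentially. n \<ge> max 1 (8 * r)"
    by (rule eventually_ge_at_top)
  ultimately have "\<forall>\<^sub>F n in sequentially. \<forall>k\<in>{1..n div 2}.
     real (n choose k) * exp (- (real k * (\<tau> * ln (real n) * (1 - (real k + 2 * real r) / real n) ^ r)))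
       \<le> exp (- (\<delta> * ln (real n))) ^ k"
  proof eventually_elim
    case (elim n)
    have n: "real n > 0" "n \<ge> 8 * r" "n \<ge> 1" using elim by auto
    have ln: "ln (real n) \<ge> 0" using n by simp
    have rn: "2 * real r \<le> \<epsilon> * real n"
      using elim(1) \<epsilon> by (simp add: field_simps)
    show ?case
    proof
      fix k assume k: "k \<in> {1..n div 2}"
      define y where "y = 1 - (real k + 2 * real r) / real n"
      have "real (n choose k) * exp (- (real k * (\<tau> * ln (real n) * y ^ r)))
          \<le> exp (- (real k * (\<delta> * ln (real n))))"
      proof (cases "real k \<le> \<epsilon> * real n")
        case True
        have "real k + 2 * real r \<le> (1 - c) * real n"
          using True rn by (simp add: \<epsilon>_def field_simps)
        then have "c \<le> y"
          using n by (simp add: y_def field_simps)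
        then have "\<tau> * c ^ r \<le> \<tau> * y ^ r"
          using assms c by (intro mult_left_mono power_mono) auto
        then have "1 + \<delta> \<le> \<tau> * y ^ r"
          using c \<delta> by (simp add: field_simps)
        then have "ln (real n) * (1 + \<delta>) \<le> ln (real n) * (\<tau> * y ^ r)"
          using ln by (rule mult_left_mono)
        then have *: "real k * (ln (real n) * (1 + \<delta>)) \<le> real k * (ln (real n) * (\<tau> * y ^ r))"
          by (rule mult_left_mono) simp
        have "real (n choose k) \<le> real (n ^ k)"
          using k by (intro of_nat_mono binomial_le_pow) auto
        also have "\<dots> = exp (real k * ln (real n))"
          using n by (simp add: exp_of_nat_mult)
        finally have "real (n choose k) * exp (- (real k * (\<tau> * ln (real n) * y ^ r)))
            \<le> exp (real k * ln (real n)) * exp (- (real k * (\<tau> * ln (real n) * y ^ r)))"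
          by (rule mult_right_mono) simp
        also have "\<dots> \<le> exp (- (real k * (\<delta> * ln (real n))))"
          unfolding exp_add[symmetric] using * by (simp add: algebra_simps)
        finally show ?thesis .
      next
        case False
        have "real k \<le> real n / 2" "8 * real r \<le> real n"
          using k n by auto
        then have "1 / 4 \<le> y"
          using n by (simp add: y_def field_simps)
        then have "\<tau> * (1 / 4) ^ r \<le> \<tau> * y ^ r"
          using assms by (intro mult_left_mono power_mono) auto
        then have "ln (real n) * c2 \<le> ln (real n) * (\<tau> * y ^ r)"
          unfolding c2_def using ln by (rule mult_left_mono)
        moreover have "ln (real n) * (2 * \<delta>) \<le> ln (real n) * c2"
          using ln \<delta> by (intro mult_left_mono) auto
        moreover have "ln 2 / \<epsilon> \<le> ln (real n) * c2 / 2"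
          using elim(2) \<epsilon> c2 by (simp add: field_simps)
        ultimately have "ln 2 / \<epsilon> + \<delta> * ln (real n) \<le> \<tau> * ln (real n) * y ^ r"
          by (simp add: algebra_simps)
        then have *: "real k * (ln 2 / \<epsilon> + \<delta> * ln (real n)) \<le> real k * (\<tau> * ln (real n) * y ^ r)"
          by (rule mult_left_mono) simp
        \<comment> \<open>This turns the entropy bound \<open>2 ^ n\<close> into a constant cost
          \<open>ln 2 / \<epsilon>\<close> per flipped node.\<close>
        have "real n \<le> real k / \<epsilon>"
          using False \<epsilon> by (simp add: field_simps)
        then have **: "real n * ln 2 \<le> real k / \<epsilon> * ln 2"
          by (rule mult_right_mono) simp
        have "n choose k \<le> 2 ^ n"
          using k by (simp add: binomial_le_pow2)
        then have "real (n choose k) \<le> real (2 ^ n)"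
          by (rule of_nat_mono)
        also have "\<dots> = exp (real n * ln 2)"
          by (simp add: exp_of_nat_mult)
        also have "\<dots> \<le> exp (real k / \<epsilon> * ln 2)"
          using ** by simp
        finally have "real (n choose k) * exp (- (real k * (\<tau> * ln (real n) * y ^ r)))
            \<le> exp (real k / \<epsilon> * ln 2) * exp (- (real k * (\<tau> * ln (real n) * y ^ r)))"
          by (rule mult_right_mono) simp
        also have "\<dots> \<le> exp (- (real k * (\<delta> * ln (real n))))"
          unfolding exp_add[symmetric] using * by (simp add: algebra_simps)
        finally show ?thesis .
      qed
      also have "\<dots> = exp (- (\<delta> * ln (real n))) ^ k"
        by (simp add: exp_of_nat_mult[symmetric])
      finally show "real (n choose k) *
          exp (- (real k * (\<tau> * ln (real n) * (1 - (real k + 2 * real r) / real n) ^ r)))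
          \<le> exp (- (\<delta> * ln (real n))) ^ k"
        by (simp add: y_def)
    qed
  qed
  with \<delta> show ?thesis by blast
qed

lemma sum_power_le_geometric:
  fixes x :: real
  assumes "0 \<le> x" "x < 1"
  shows "(\<Sum>k=1..N. x ^ k) \<le> x / (1 - x)"
proof -
  have "(\<Sum>k=1..N. x ^ k) = x * (\<Sum>k<N. x ^ k)"
    unfolding sum_distrib_left by (rule sum.reindex_bij_witness[of _ Suc "\<lambda>k. k - 1"])
      (auto simp flip: power_Suc)
  also have "\<dots> \<le> x * (1 / (1 - x))"
    using assms by (intro mult_left_mono) (auto simp: sum_gp_strict divide_right_mono)
  finally show ?thesis by simp
qed

section \<open>Global sign symmetry and reduction to small flip sets\<close>

lemma likelihood_uminus:
  assumes "\<And>i. i \<in> {1..n} \<Longrightarrow> \<eta>' i = - \<eta> i"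
  shows "likelihood m n p q a A \<eta>' = likelihood m n p q a A \<eta>"
proof -
  have "I_plus n \<eta>' = I_minus n \<eta>" "I_minus n \<eta>' = I_plus n \<eta>"
    using assms by (auto simp: I_plus_def I_minus_def)
  then have "edge_prob n p q \<eta>' = edge_prob n p q \<eta>"
    by (auto simp: edge_prob_def fun_eq_iff)
  then show ?thesis
    by (simp add: likelihood_def observation_pmf_def)
qed

text \<open>
  The size restriction can be met by replacing \<open>\<eta>\<close> by \<open>-\<eta>\<close>, which complements the set of flipped
  nodes and preserves the likelihood.
\<close>

lemma exists_flip_of_wrong_label:
  assumes \<sigma>: "\<sigma> \<in> labelings n" and \<eta>: "\<eta> \<in> labelings n"
    and ge: "likelihood m n p q a A \<sigma> \<le> likelihood m n p q a A \<eta>"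
    and neq: "\<not> (\<exists>s\<in>{1, -1}. \<forall>i\<in>{1..n}. \<eta> i = s * \<sigma> i)"
  shows "\<exists>S. S \<subseteq> {1..n} \<and> card S \<in> {1..n div 2} \<and>
             likelihood m n p q a A \<sigma> \<le> likelihood m n p q a A (flip S \<sigma>)"
proof -
  define T where "T = {i \<in> {1..n}. \<eta> i \<noteq> \<sigma> i}"
  have sub: "T \<subseteq> {1..n}" by (auto simp: T_def)
  have vals: "\<sigma> i \<in> {1, -1}" "\<eta> i \<in> {1, -1}" if "i \<in> {1..n}" for i
    using \<sigma> \<eta> that by (auto simp: labelings_def)
  have out: "\<sigma> i = undefined" "\<eta> i = undefined" if "i \<notin> {1..n}" for i
    using \<sigma> \<eta> that by (auto simp: labelings_def PiE_def extensional_def)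
  have opp: "\<eta> i = - \<sigma> i" if "i \<in> T" for i
    using that vals[of i] by (auto simp: T_def)
  have ne: "T \<noteq> {}" using neq by (auto simp: T_def)
  have ne': "{1..n} - T \<noteq> {}"
  proof
    assume "{1..n} - T = {}"
    then have "\<forall>i\<in>{1..n}. \<eta> i = (-1) * \<sigma> i"
      using opp by auto
    then show False using neq by blast
  qed
  have fin: "finite T" using sub finite_subset by blast
  have cards: "card T \<ge> 1" "card ({1..n} - T) \<ge> 1" "card T + card ({1..n} - T) = n"
  proof -
    show "card T \<ge> 1" "card ({1..n} - T) \<ge> 1"
      unfolding One_nat_def Suc_le_eq card_gt_0_iff using ne ne' fin by auto
    show "card T + card ({1..n} - T) = n"
      using card_Diff_subset[OF fin sub] card_mono[OF _ sub] by simp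
  qed
  have 1: "likelihood m n p q a A (flip T \<sigma>) = likelihood m n p q a A \<eta>"
  proof -
    have "flip T \<sigma> i = \<eta> i" for i
      using out[of i] opp[of i] by (cases "i \<in> {1..n}") (auto simp: flip_def T_def)
    then have "flip T \<sigma> = \<eta>" ..
    then show ?thesis by simp
  qed
  \<comment> \<open>The flipped function equals \<open>-\<eta>\<close> on the nodes but keeps the
    value \<open>undefined\<close> elsewhere; the sign symmetry therefore asks for opposite labels
    on \<open>{1..n}\<close> only.\<close>
  have 2: "likelihood m n p q a A (flip ({1..n} - T) \<sigma>) = likelihood m n p q a A \<eta>"
  proof (rule likelihood_uminus)
    fix i assume "i \<in> {1..n}"
    then show "flip ({1..n} - T) \<sigma> i = - \<eta> i"
      using opp[of i] by (cases "i \<in> T") (auto simp: flip_def T_def)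
  qed
  show ?thesis
  proof (cases "card T \<le> n div 2")
    case True
    then show ?thesis using cards sub 1 ge by (intro exI[of _ T]) auto
  next
    case False
    then show ?thesis using cards 2 ge by (intro exI[of _ "{1..n} - T"]) auto
  qed
qed

text \<open>Conditional error bound for fixed labels: a wrong estimate puts the observation into
  some \<open>B S\<close>. These events are grouped by \<open>card S\<close>, and \<open>x\<close>
  is the ratio of the dominating geometric series. Any choice among the maximizers is
  covered.\<close>

lemma prob_bad_observation_le:
  fixes p q t :: real
  assumes pq: "0 < p" "p < 1" "0 < q" "q < 1"
    and r: "r \<ge> 1" and n: "n \<ge> 1" "n \<ge> 8 * r"
    and \<sigma>: "\<sigma> \<in> labelings n"
    and a: "a = t * ln (real n) / real n ^ r" "0 \<le> a" "a \<le> 1"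
    and I: "I = I_threshold (Suc r) p q"
    and x: "0 \<le> x" "x < 1"
    and bound: "\<And>k. k \<in> {1..n div 2} \<Longrightarrow> real (n choose k) *
       exp (- (real k * (t / I * ln (real n) * (1 - (real k + 2 * real r) / real n) ^ r))) \<le> x ^ k"
    and mle: "\<And>A. is_MLE (Suc r) n p q a A (est A)"
  shows "measure_pmf.prob (observation_pmf (Suc r) n p q a \<sigma>)
           {A. \<not> (\<exists>s\<in>{1, -1}. \<forall>i\<in>{1..n}. est A i = s * \<sigma> i)} \<le> x / (1 - x)"
proof -
  let ?M = "observation_pmf (Suc r) n p q a \<sigma>"
  define D where "D = (sqrt p - sqrt q)\<^sup>2 + (sqrt (1 - p) - sqrt (1 - q))\<^sup>2"
  define \<S> where "\<S> = {S. S \<subseteq> {1..n} \<and> card S \<in> {1..n div 2}}"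
  define g where "g = (\<lambda>k. exp (- (real k * (t / I * ln (real n) *
                        (1 - (real k + 2 * real r) / real n) ^ r))))"
  define B where "B = (\<lambda>S. {A. likelihood (Suc r) n p q a A \<sigma> \<le> likelihood (Suc r) n p q a A (flip S \<sigma>)})"
  have fin: "finite \<S>"
    unfolding \<S>_def by (rule finite_subset[of _ "Pow {1..n}"]) auto
  have D0: "D \<ge> 0" by (simp add: D_def)
  have B: "measure_pmf.prob ?M (B S) \<le> g (card S)" if "S \<in> \<S>" for S
  proof -
    let ?k = "real (card S)"
    let ?N = "?k * (2 * ((real n - ?k - 2 * real r) / 2) ^ r) / fact r"
    have S: "S \<subseteq> {1..n}" "card S \<le> n div 2" using that by (auto simp: \<S>_def)
    have "measure_pmf.prob ?M (B S)
        \<le> exp (- (a * D / 2 * real (card (discordant (Suc r) n \<sigma> (flip S \<sigma>)))))"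
      unfolding B_def D_def by (rule prob_likelihood_ge) (use pq a in auto)
    also have "\<dots> \<le> exp (- (a * D / 2 * ?N))"
    proof -
      have "?N \<le> real (card (discordant (Suc r) n \<sigma> (flip S \<sigma>)))"
        using S n by (intro discordant_lower_bound \<sigma> r) auto
      then have "a * D / 2 * ?N \<le> a * D / 2 * real (card (discordant (Suc r) n \<sigma> (flip S \<sigma>)))"
        using a(2) D0 by (intro mult_left_mono) auto
      then show ?thesis by simp
    qed
    \<comment> \<open>Here the threshold emerges: \<open>I\<close> is
      \<open>2 ^ r * fact r / D\<close>, so the exponent is \<open>t / I\<close> times
      \<open>k * ln n\<close> up to the factor tending to 1 for fixed \<open>k\<close>.\<close>
    also have "a * D / 2 * ?N = ?k * (t / I * ln (real n) * (1 - (?k + 2 * real r) / real n) ^ r)"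
    proof -
      have "1 - (?k + 2 * real r) / real n = (real n - ?k - 2 * real r) / real n"
        using n by (simp add: field_simps)
      then have "(1 - (?k + 2 * real r) / real n) ^ r = (real n - ?k - 2 * real r) ^ r / real n ^ r"
        by (simp add: power_divide)
      moreover have "t / I = t * D / (2 ^ r * fact r)"
        by (simp add: I I_threshold_def D_def)
      ultimately show ?thesis
        by (simp add: a(1) power_divide mult_ac)
    qed
    finally show ?thesis by (simp add: g_def)
  qed
  have "{A. \<not> (\<exists>s\<in>{1, -1}. \<forall>i\<in>{1..n}. est A i = s * \<sigma> i)} \<subseteq> (\<Union>S\<in>\<S>. B S)"
  proof
    fix A assume "A \<in> {A. \<not> (\<exists>s\<in>{1, -1}. \<forall>i\<in>{1..n}. est A i = s * \<sigma> i)}"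
    then have neq: "\<not> (\<exists>s\<in>{1, -1}. \<forall>i\<in>{1..n}. est A i = s * \<sigma> i)" by simp
    have "est A \<in> labelings n"
      "likelihood (Suc r) n p q a A \<sigma> \<le> likelihood (Suc r) n p q a A (est A)"
      using mle[of A] \<sigma> by (auto simp: is_MLE_def is_arg_max_def not_less)
    from exists_flip_of_wrong_label[OF \<sigma> this neq] show "A \<in> (\<Union>S\<in>\<S>. B S)"
      unfolding \<S>_def B_def by blast
  qed
  then have "measure_pmf.prob ?M {A. \<not> (\<exists>s\<in>{1, -1}. \<forall>i\<in>{1..n}. est A i = s * \<sigma> i)}
      \<le> measure_pmf.prob ?M (\<Union>S\<in>\<S>. B S)"
    by (rule measure_pmf.finite_measure_mono) simp
  also have "\<dots> \<le> (\<Sum>S\<in>\<S>. measure_pmf.prob ?M (B S))"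
    by (rule measure_pmf.finite_measure_subadditive_finite) (use fin in auto)
  also have "\<dots> \<le> (\<Sum>S\<in>\<S>. g (card S))"
    by (intro sum_mono B)
  also have "\<dots> = (\<Sum>k=1..n div 2. \<Sum>S\<in>{S \<in> \<S>. card S = k}. g (card S))"
    by (rule sum.group[symmetric]) (use fin in \<open>auto simp: \<S>_def\<close>)
  also have "\<dots> = (\<Sum>k=1..n div 2. real (n choose k) * g k)"
  proof (rule sum.cong[OF refl])
    fix k assume "k \<in> {1..n div 2}"
    then have "{S \<in> \<S>. card S = k} = {S. S \<subseteq> {1..n} \<and> card S = k}"
      by (auto simp: \<S>_def)
    then have "card {S \<in> \<S>. card S = k} = n choose k"
      by (simp add: n_subsets)
    then show "(\<Sum>S\<in>{S \<in> \<S>. card S = k}. g (card S)) = real (n choose k) * g k"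
      by simp
  qed
  also have "\<dots> \<le> (\<Sum>k=1..n div 2. x ^ k)"
    unfolding g_def by (intro sum_mono bound)
  also have "\<dots> \<le> x / (1 - x)"
    by (rule sum_power_le_geometric) (use x in auto)
  finally show ?thesis .
qed

section \<open>Averaging over the labels and passing to the limit\<close>

lemma prob_censored_hsbm_le:
  assumes "\<And>\<sigma>. \<sigma> \<in> labelings n \<Longrightarrow>
      measure_pmf.prob (observation_pmf m n p q a \<sigma>) {A. P \<sigma> A} \<le> c"
    and "0 \<le> c"
  shows "measure_pmf.prob (censored_hsbm m n p q a) {(\<sigma>, A). P \<sigma> A} \<le> c"
proof -
  have lab: "set_pmf (label_pmf n) \<subseteq> labelings n"
    unfolding label_pmf_def labelings_def
    by (auto simp: set_Pi_pmf PiE_dflt_def PiE_def extensional_def)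
  \<comment> \<open>The error probability is the mean of its conditional versions, so a bound
    uniform over all labellings carries over.\<close>
  have "emeasure (measure_pmf (censored_hsbm m n p q a)) {(\<sigma>, A). P \<sigma> A}
      = (\<integral>\<^sup>+ \<sigma>. emeasure (measure_pmf (observation_pmf m n p q a \<sigma>)) {A. P \<sigma> A} \<partial>label_pmf n)"
    unfolding censored_hsbm_def
    by (simp add: emeasure_bind_pmf map_pmf_def[symmetric] vimage_def)
  also have "\<dots> \<le> (\<integral>\<^sup>+ \<sigma>. ennreal c \<partial>label_pmf n)"
    by (rule nn_integral_mono_AE)
      (use lab assms(1) in \<open>auto simp: AE_measure_pmf_iff measure_pmf.emeasure_eq_measure
         intro!: ennreal_leI\<close>)
  also have "\<dots> = ennreal c"
    by simp
  finally show ?thesis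
    using assms(2) by (simp add: measure_pmf.emeasure_eq_measure)
qed

theorem theorem2p2:
  fixes m :: nat and p q t :: real and \<alpha> :: "nat \<Rightarrow> real"
    and \<sigma>hat :: "nat \<Rightarrow> (nat set \<Rightarrow> obs) \<Rightarrow> (nat \<Rightarrow> int)"
  assumes "m \<ge> 2"
    and "0 < p" "p < 1" "0 < q" "q < 1" "p > q"
    and "t > 0"
    and "\<And>n. \<alpha> n = t * ln (real n) / real n ^ (m - 1)"
    and "\<And>n A. is_MLE m n p q (\<alpha> n) A (\<sigma>hat n A)"
    and "t > I_threshold m p q"
  shows "(\<lambda>n. measure_pmf.prob (censored_hsbm m n p q (\<alpha> n))
             {(\<sigma>, A). \<exists>s\<in>{1, -1}. \<forall>i\<in>{1..n}. \<sigma>hat n A i = s * \<sigma> i})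
         \<longlonglongrightarrow> 1"
proof -
  define r where "r = m - 1"
  have r: "r \<ge> 1" "m = Suc r" using \<open>m \<ge> 2\<close> by (auto simp: r_def)
  define I where "I = I_threshold m p q"
  have "(sqrt p - sqrt q)\<^sup>2 > 0" using \<open>p > q\<close> by simp
  then have "I > 0"
    unfolding I_def I_threshold_def by (intro divide_pos_pos add_pos_nonneg) auto
  then have "t / I > 1" using assms(10) by (simp add: I_def)
  from binomial_mult_exp_bound[OF this r(1)] obtain \<delta> where \<delta>: "\<delta> > 0"
    and bound: "\<forall>\<^sub>F n in sequentially. \<forall>k\<in>{1..n div 2}.
      real (n choose k) * exp (- (real k * (t / I * ln (real n) *
        (1 - (real k + 2 * real r) / real n) ^ r))) \<le> exp (- (\<delta> * ln (real n))) ^ k"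
    by blast
  define x where "x = (\<lambda>n. exp (- (\<delta> * ln (real n))))"
  define good where "good = (\<lambda>n. {(\<sigma>, A). \<exists>s\<in>{1, -1}. \<forall>i\<in>{1..n}. \<sigma>hat n A i = s * \<sigma> i})"
  let ?M = "\<lambda>n. censored_hsbm m n p q (\<alpha> n)"
  \<comment> \<open>The ratio \<open>x n\<close> is \<open>n powr -\<delta>\<close> for positive
    \<open>n\<close>, so the geometric series bound vanishes.\<close>
  have lim: "(\<lambda>n. 1 - x n / (1 - x n)) \<longlonglongrightarrow> 1"
    unfolding x_def using \<delta> by real_asymp
  have "(\<lambda>n. ln (real n) / real n) \<longlonglongrightarrow> 0"
    by real_asymp
  then have "(\<lambda>n. t * (ln (real n) / real n)) \<longlonglongrightarrow> t * 0"
    by (intro tendsto_intros)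
  then have "\<forall>\<^sub>F n in sequentially. t * (ln (real n) / real n) < 1"
    by (rule order_tendstoD) simp
  moreover have "\<forall>\<^sub>F n in sequentially. x n < 1"
    unfolding x_def using \<delta> by real_asymp
  moreover have "\<forall>\<^sub>F n in sequentially. n \<ge> max 1 (8 * r)"
    by (rule eventually_ge_at_top)
  ultimately have lower: "\<forall>\<^sub>F n in sequentially. 1 - x n / (1 - x n) \<le> measure_pmf.prob (?M n) (good n)"
    using bound
  proof eventually_elim
    case (elim n)
    have n: "n \<ge> 1" "n \<ge> 8 * r" using elim by auto
    have \<alpha>: "\<alpha> n = t * ln (real n) / real n ^ r"
      by (simp add: assms(8) r_def)
    have \<alpha>0: "\<alpha> n \<ge> 0"
      unfolding \<alpha> using n \<open>t > 0\<close> by simp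
    \<comment> \<open>By \<open>r \<ge> 1\<close>, \<open>\<alpha> n\<close> is at most
      \<open>t * ln n / n\<close>, which is eventually below 1; from then on
      \<open>bernoulli_pmf\<close> does not truncate it.\<close>
    have "real n ^ 1 \<le> real n ^ r"
      using n r by (intro power_increasing) auto
    then have "\<alpha> n \<le> t * ln (real n) / real n"
      unfolding \<alpha> using n \<open>t > 0\<close> by (intro divide_left_mono mult_nonneg_nonneg) auto
    then have \<alpha>1: "\<alpha> n \<le> 1" using elim(1) by simp
    have x: "0 \<le> x n" by (simp add: x_def)
    have "measure_pmf.prob (?M n)
        {(\<sigma>, A). \<not> (\<exists>s\<in>{1, -1}. \<forall>i\<in>{1..n}. \<sigma>hat n A i = s * \<sigma> i)} \<le> x n / (1 - x n)"
    proof (rule prob_censored_hsbm_le)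
      fix \<sigma> assume \<sigma>: "\<sigma> \<in> labelings n"
      show "measure_pmf.prob (observation_pmf m n p q (\<alpha> n) \<sigma>)
          {A. \<not> (\<exists>s\<in>{1, -1}. \<forall>i\<in>{1..n}. \<sigma>hat n A i = s * \<sigma> i)} \<le> x n / (1 - x n)"
        unfolding r(2)
        by (rule prob_bad_observation_le[OF assms(2-5) r(1) n \<sigma> \<alpha> \<alpha>0 \<alpha>1 I_def[unfolded r(2)] x elim(2)])
          (use elim(4) assms(9) r(2) in \<open>auto simp: x_def\<close>)
    qed (use x elim(2) in simp)
    moreover have "{(\<sigma>, A). \<not> (\<exists>s\<in>{1, -1}. \<forall>i\<in>{1..n}. \<sigma>hat n A i = s * \<sigma> i)}
        = space (measure_pmf (?M n)) - good n"
      by (auto simp: good_def)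
    ultimately show ?case
      using measure_pmf.prob_compl[of "good n" "?M n"] by simp
  qed
  have "(\<lambda>n. measure_pmf.prob (?M n) (good n)) \<longlonglongrightarrow> 1"
    by (rule tendsto_sandwich[OF lower _ lim tendsto_const]) simp
  then show ?thesis
    unfolding good_def .
qed

end
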